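(* Let $\mathbf{C}$ be a category in which every morphism is monic, and let $\mathbf{B}$ be a (not necessarily full) subcategory of $\mathbf{C}$. Let $B\in\mathrm{Ob}(\mathbf{B})$ and $C\in\mathrm{Ob}(\mathbf{C})$ with $\hom_{\mathbf{C}}(B,C)\neq\varnothing$ (so that $\overline{\mathrm{Age}}_{\mathbf{B}}(B)$ is a subcategory of $\overline{\mathrm{Age}}_{\mathbf{C}}(C)$). Let $A\in\mathrm{Ob}(\overline{\mathrm{Age}}_{\mathbf{B}}(B))$ and assume that for every $(A,B)$-diagram $F:\Delta\to\overline{\mathrm{Age}}_{\mathbf{B}}(B)$ the following holds: if $F$ (viewed as a diagram in $\overline{\mathrm{Age}}_{\mathbf{C}}(C)$) has a commuting cocone in $\overline{\mathrm{Age}}_{\mathbf{C}}(C)$ whose tip is $C$, then $F$ has a commuting cocone in $\overline{\mathrm{Age}}_{\mathbf{B}}(B)$. Then $T_{\mathbf{B}}(A,B)\le T_{\mathbf{C}}(A,C)$.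
   Context: A morphism $f$ is monic if $f\cdot g=f\cdot h$ implies $g=h$. For a category $\mathbf{C}$ and $C\in\mathrm{Ob}(\mathbf{C})$, $\overline{\mathrm{Age}}_{\mathbf{C}}(C)$ is the full subcategory of $\mathbf{C}$ spanned by all objects $A$ with $\hom_{\mathbf{C}}(A,C)\neq\varnothing$. An oriented multigraph $\Delta$ consists of vertices, arrows and maps assigning to each arrow a domain and codomain; a diagram of shape $\Delta$ in a category is a map sending vertices to objects and each arrow $g:\delta\to\gamma$ to a morphism $F(g):F(\delta)\to F(\gamma)$. A binary digraph is an acyclic bipartite (possibly infinite) digraph with a "bottom row" and a "top row" of vertices, all arrows going from bottom row vertices to top row vertices, each bottom row vertex having out-degree exactly 2. An $(A,B)$-diagram is a diagram $F:\Delta\to\mathbf{C}$ where $\Delta$ is a binary digraph, $F$ sends every bottom row vertex to $A$ and every top row vertex to $B$. A commuting cocone over a diagram $F:\Delta\to\mathbf{D}$ in $\mathbf{D}$ is an object $D$ (its tip) with morphisms $e_\delta:F(\delta)\to D$ for all vertices $\delta$ such that $e_\gamma\cdot F(g)=e_\delta$ for every arrow $g:\delta\to\gamma$. Write $C\longrightarrow(B)^A_{k,t}$ if for every map $\chi:\hom(A,C)\to\{0,\dots,k-1\}$ there is $w\in\hom(B,C)$ with $|\chi(w\cdot\hom(A,B))|\le t$. $T(A,C)$ (computed in the indicated category) is the least positive integer $t$ with $C\longrightarrow(C)^A_{k,t}$ for all $k\ge2$, and $\infty$ if none exists. *)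

theory Defs
  imports
    Main
    "HOL-Library.FuncSet"
    "HOL-Library.Extended_Nat"
    "Graph_Theory.Digraph"
begin

record ('o, 'm) cat =
  Obj :: "'o set"
  Arr :: "'m set"
  Dom :: "'m \<Rightarrow> 'o"
  Cod :: "'m \<Rightarrow> 'o"
  Ident :: "'o \<Rightarrow> 'm"
  Comp :: "'m \<Rightarrow> 'm \<Rightarrow> 'm"  (* Comp g f is "g after f" *)

definition Hom :: "('o, 'm) cat \<Rightarrow> 'o \<Rightarrow> 'o \<Rightarrow> 'm set" where
  "Hom C X Y = {f \<in> Arr C. Dom C f = X \<and> Cod C f = Y}"

locale category =
  fixes C :: "('o, 'm) cat"
  assumes Dom_in: "f \<in> Arr C \<Longrightarrow> Dom C f \<in> Obj C"
    and Cod_in: "f \<in> Arr C \<Longrightarrow> Cod C f \<in> Obj C"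
    and Ident_in: "X \<in> Obj C \<Longrightarrow> Ident C X \<in> Hom C X X"
    and Comp_in: "\<lbrakk>f \<in> Hom C X Y; g \<in> Hom C Y Z\<rbrakk> \<Longrightarrow> Comp C g f \<in> Hom C X Z"
    and Ident_left: "f \<in> Hom C X Y \<Longrightarrow> Comp C (Ident C Y) f = f"
    and Ident_right: "f \<in> Hom C X Y \<Longrightarrow> Comp C f (Ident C X) = f"
    and Comp_assoc: "\<lbrakk>f \<in> Hom C W X; g \<in> Hom C X Y; h \<in> Hom C Y Z\<rbrakk>
          \<Longrightarrow> Comp C h (Comp C g f) = Comp C (Comp C h g) f"

definition monic :: "('o, 'm) cat \<Rightarrow> 'm \<Rightarrow> bool" where
  "monic C f \<longleftrightarrow> f \<in> Arr C \<and>
     (\<forall>X \<in> Obj C. \<forall>g \<in> Hom C X (Dom C f). \<forall>h \<in> Hom C X (Dom C f).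
        Comp C f g = Comp C f h \<longrightarrow> g = h)"

definition subcategory :: "('o, 'm) cat \<Rightarrow> ('o, 'm) cat \<Rightarrow> bool" where
  "subcategory B C \<longleftrightarrow> category B \<and> category C \<and>
     Obj B \<subseteq> Obj C \<and> Arr B \<subseteq> Arr C \<and>
     (\<forall>f \<in> Arr B. Dom B f = Dom C f \<and> Cod B f = Cod C f) \<and>
     (\<forall>X \<in> Obj B. Ident B X = Ident C X) \<and>
     (\<forall>f \<in> Arr B. \<forall>g \<in> Arr B. Cod B f = Dom B g \<longrightarrow> Comp B g f = Comp C g f)"

definition full_subcat :: "('o, 'm) cat \<Rightarrow> 'o set \<Rightarrow> ('o, 'm) cat" where
  "full_subcat C S = C\<lparr>Obj := Obj C \<inter> S, Arr := {f \<in> Arr C. Dom C f \<in> S \<and> Cod C f \<in> S}\<rparr>"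

definition Age :: "('o, 'm) cat \<Rightarrow> 'o \<Rightarrow> ('o, 'm) cat" where
  "Age C X = full_subcat C {A \<in> Obj C. Hom C A X \<noteq> {}}"

text \<open>An oriented multigraph is a \<^locale>\<open>wf_digraph\<close> of the graph library, with
  \<^const>\<open>tail\<close> as domain and \<^const>\<open>head\<close> as codomain of an arrow. A diagram is given by its
  action \<open>Fo\<close> on vertices and its action \<open>Fa\<close> on arrows.\<close>

definition diagram ::
  "('o, 'm) cat \<Rightarrow> ('v, 'e) pre_digraph \<Rightarrow> ('v \<Rightarrow> 'o) \<Rightarrow> ('e \<Rightarrow> 'm) \<Rightarrow> bool" where
  "diagram C \<Delta> Fo Fa \<longleftrightarrow> wf_digraph \<Delta> \<and>
     (\<forall>v \<in> verts \<Delta>. Fo v \<in> Obj C) \<and>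
     (\<forall>a \<in> arcs \<Delta>. Fa a \<in> Hom C (Fo (tail \<Delta> a)) (Fo (head \<Delta> a)))"

text \<open>A digraph has no parallel arrows, so the two arrows leaving a bottom row vertex end in
  distinct top row vertices.\<close>

definition binary_digraph :: "('v, 'e) pre_digraph \<Rightarrow> 'v set \<Rightarrow> 'v set \<Rightarrow> bool" where
  "binary_digraph \<Delta> Lo Up \<longleftrightarrow> nomulti_digraph \<Delta> \<and>
     verts \<Delta> = Lo \<union> Up \<and> Lo \<inter> Up = {} \<and>
     (\<forall>a \<in> arcs \<Delta>. tail \<Delta> a \<in> Lo \<and> head \<Delta> a \<in> Up) \<and>
     (\<forall>v \<in> Lo. out_degree \<Delta> v = 2)"

lemma binary_digraph_acyclic:
  assumes "binary_digraph \<Delta> Lo Up"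
  shows "acyclic (arcs_ends \<Delta>)"
proof (rule acyclicI, intro allI notI)
  fix x assume x: "(x, x) \<in> (arcs_ends \<Delta>)\<^sup>+"
  have ends: "arcs_ends \<Delta> \<subseteq> Lo \<times> Up"
    using assms by (auto simp: binary_digraph_def arcs_ends_conv)
  then have "(x, x) \<in> Lo \<times> Up"
    using x tranclD[OF x] tranclD2[OF x] by blast
  then show False
    using assms by (auto simp: binary_digraph_def)
qed

text \<open>HOL cannot quantify over the types of vertices and arrows inside a hypothesis. A hypothesis
  about all \<open>(A, B)\<close>-diagrams in a category with morphisms of type \<open>'m\<close> is stated for shapes
  with vertices and arrows in \<open>'m list\<close>, which is infinite and at least as large as \<open>'m\<close>. This
  is an instance of the hypothesis for all shapes, so assuming it loses no generality.\<close>

definition AB_diagram ::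
  "('o, 'm) cat \<Rightarrow> 'o \<Rightarrow> 'o \<Rightarrow> ('v, 'e) pre_digraph \<Rightarrow> 'v set \<Rightarrow> 'v set
    \<Rightarrow> ('v \<Rightarrow> 'o) \<Rightarrow> ('e \<Rightarrow> 'm) \<Rightarrow> bool" where
  "AB_diagram C A B \<Delta> Lo Up Fo Fa \<longleftrightarrow>
     binary_digraph \<Delta> Lo Up \<and> diagram C \<Delta> Fo Fa \<and>
     (\<forall>v \<in> Lo. Fo v = A) \<and> (\<forall>v \<in> Up. Fo v = B)"

definition commuting_cocone ::
  "('o, 'm) cat \<Rightarrow> ('v, 'e) pre_digraph \<Rightarrow> ('v \<Rightarrow> 'o) \<Rightarrow> ('e \<Rightarrow> 'm)
    \<Rightarrow> 'o \<Rightarrow> ('v \<Rightarrow> 'm) \<Rightarrow> bool" where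
  "commuting_cocone C \<Delta> Fo Fa D e \<longleftrightarrow> D \<in> Obj C \<and>
     (\<forall>v \<in> verts \<Delta>. e v \<in> Hom C (Fo v) D) \<and>
     (\<forall>a \<in> arcs \<Delta>. Comp C (e (head \<Delta> a)) (Fa a) = e (tail \<Delta> a))"

text \<open>The relation \<open>Z \<longrightarrow> (Y)\<^sup>A\<^bsub>k,t\<^esub>\<close>, with arguments in the order \<open>Z Y A k t\<close>.\<close>

definition ramsey_arrow :: "('o, 'm) cat \<Rightarrow> 'o \<Rightarrow> 'o \<Rightarrow> 'o \<Rightarrow> nat \<Rightarrow> nat \<Rightarrow> bool" where
  "ramsey_arrow C Z Y A k t \<longleftrightarrow>
     (\<forall>\<chi> \<in> Hom C A Z \<rightarrow> {..<k}. \<exists>w \<in> Hom C Y Z. card (\<chi> ` Comp C w ` Hom C A Y) \<le> t)"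

definition T :: "('o, 'm) cat \<Rightarrow> 'o \<Rightarrow> 'o \<Rightarrow> enat" where
  "T C A Z =
     (if \<exists>t \<ge> 1. \<forall>k \<ge> 2. ramsey_arrow C Z Z A k t
      then enat (LEAST t. t \<ge> 1 \<and> (\<forall>k \<ge> 2. ramsey_arrow C Z Z A k t))
      else \<infinity>)"

lemma Hom_Age:
  "Hom (Age C X) Y Z =
     (if {Y, Z} \<subseteq> {A \<in> Obj C. Hom C A X \<noteq> {}} then Hom C Y Z else {})"
  by (auto simp: Hom_def Age_def full_subcat_def)

lemma category_Age:
  assumes "category C"
  shows "category (Age C X)"
proof -
  interpret category C by fact
  have simps: "Ident (Age C X) = Ident C" "Comp (Age C X) = Comp C"
    by (simp_all add: Age_def full_subcat_def)
  show ?thesis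
  proof
    fix f assume "f \<in> Arr (Age C X)"
    then show "Dom (Age C X) f \<in> Obj (Age C X)" "Cod (Age C X) f \<in> Obj (Age C X)"
      by (auto simp: Age_def full_subcat_def)
  next
    fix Y assume "Y \<in> Obj (Age C X)"
    then show "Ident (Age C X) Y \<in> Hom (Age C X) Y Y"
      using Ident_in by (auto simp: Hom_Age simps) (auto simp: Age_def full_subcat_def)
  qed (auto simp: Hom_Age simps Ident_left Ident_right intro: Comp_in Comp_assoc split: if_splits)
qed

lemma subcategory_Age:
  assumes "subcategory BB CC" "B \<in> Obj BB" "Hom CC B C \<noteq> {}"
  shows "subcategory (Age BB B) (Age CC C)"
proof -
  have cat: "category BB" "category CC"
    using assms(1) by (simp_all add: subcategory_def)
  obtain e where e: "e \<in> Hom CC B C"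
    using assms(3) by blast
  have obj: "X \<in> Obj CC \<and> Hom CC X C \<noteq> {}" if "X \<in> Obj BB" "f \<in> Hom BB X B" for X f
  proof -
    have "f \<in> Hom CC X B"
      using that assms(1) by (auto simp: subcategory_def Hom_def)
    then have "Comp CC e f \<in> Hom CC X C"
      using e category.Comp_in[OF cat(2)] by blast
    then show ?thesis
      using that assms(1) by (auto simp: subcategory_def)
  qed
  have "Obj (Age BB B) \<subseteq> Obj (Age CC C)"
    using obj by (auto simp: Age_def full_subcat_def)
  moreover have "Arr (Age BB B) \<subseteq> Arr (Age CC C)"
  proof
    fix f assume f: "f \<in> Arr (Age BB B)"
    then have "Dom BB f = Dom CC f" "Cod BB f = Cod CC f" "f \<in> Arr CC"
      using assms(1) by (auto simp: subcategory_def Age_def full_subcat_def)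
    moreover have "Dom BB f \<in> Obj CC \<and> Hom CC (Dom BB f) C \<noteq> {}"
      "Cod BB f \<in> Obj CC \<and> Hom CC (Cod BB f) C \<noteq> {}"
      using f obj by (fastforce simp: Age_def full_subcat_def)+
    ultimately show "f \<in> Arr (Age CC C)"
      by (simp add: Age_def full_subcat_def)
  qed
  ultimately show ?thesis
    using assms(1) category_Age[OF cat(1)] category_Age[OF cat(2)]
    by (simp add: subcategory_def Age_def full_subcat_def)
qed

end

theory Submission
  imports Defs
begin

text \<open>
  Take one top row copy of \<open>B\<close> for each \<open>e \<in> hom\<^sub>C(B,C)\<close> and one bottom row copy of \<open>A\<close> for each
  coincidence \<open>e\<^sub>1 \<cdot> u = e\<^sub>2 \<cdot> v\<close> with \<open>e\<^sub>1 \<noteq> e\<^sub>2\<close>. The morphisms \<open>e\<close> form a cocone with tip \<open>C\<close>, so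
  there is a cocone in the age of \<open>B\<close>, and composing with a morphism from its tip to \<open>B\<close> yields
  endomorphisms \<open>f\<^sub>e\<close> of \<open>B\<close> such that \<open>e\<^sub>1 \<cdot> u = e\<^sub>2 \<cdot> v\<close> implies \<open>f\<^sub>e\<^sub>1 \<cdot> u = f\<^sub>e\<^sub>2 \<cdot> v\<close> (for \<open>e\<^sub>1 = e\<^sub>2\<close>
  by monicity). Hence a colouring \<open>\<chi>\<close> of \<open>hom\<^sub>B(A,B)\<close> transfers to \<open>hom\<^sub>C(A,C)\<close> by
  \<open>e \<cdot> u \<mapsto> \<chi>(f\<^sub>e \<cdot> u)\<close>, and if \<open>w\<close> is good for the new colouring, then \<open>f\<^sub>e\<close> with \<open>e = w \<cdot> e\<^sub>0\<close>
  is good for \<open>\<chi>\<close>.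
\<close>

lemma Comp_Age [simp]: "Comp (Age C X) = Comp C"
  by (simp add: Age_def full_subcat_def)

lemma Obj_Age: "Obj (Age C X) = {Y \<in> Obj C. Hom C Y X \<noteq> {}}"
  by (auto simp: Age_def full_subcat_def)

lemma Hom_subcategory: "subcategory B C \<Longrightarrow> Hom B X Y \<subseteq> Hom C X Y"
  by (auto simp: subcategory_def Hom_def)

lemma (in category) self_in_Age: "X \<in> Obj C \<Longrightarrow> X \<in> Obj (Age C X)"
  using Ident_in by (auto simp: Obj_Age)

text \<open>The vertex \<open>[e]\<close> is the top row copy of \<open>B\<close> indexed by \<open>e\<close>. The vertex \<open>[e\<^sub>1, e\<^sub>2, u, v]\<close> records
  the coincidence \<open>e\<^sub>1 \<cdot> u = e\<^sub>2 \<cdot> v\<close>; its two arrows are obtained by prefixing the index of the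
  target, \<open>e\<^sub>1\<close> or \<open>e\<^sub>2\<close>.\<close>

definition coincidences ::
  "('o, 'm) cat \<Rightarrow> ('o, 'm) cat \<Rightarrow> 'o \<Rightarrow> 'o \<Rightarrow> 'o \<Rightarrow> 'm list set" where
  "coincidences BB CC A B C = {[e1, e2, u, v] | e1 e2 u v.
     e1 \<in> Hom CC B C \<and> e2 \<in> Hom CC B C \<and> e1 \<noteq> e2 \<and>
     u \<in> Hom BB A B \<and> v \<in> Hom BB A B \<and> Comp CC e1 u = Comp CC e2 v}"

definition coincidence_digraph ::
  "('o, 'm) cat \<Rightarrow> ('o, 'm) cat \<Rightarrow> 'o \<Rightarrow> 'o \<Rightarrow> 'o \<Rightarrow> ('m list, 'm list) pre_digraph" where
  "coincidence_digraph BB CC A B C =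
     \<lparr>verts = coincidences BB CC A B C \<union> (\<lambda>e. [e]) ` Hom CC B C,
      arcs = {b # x | b x. x \<in> coincidences BB CC A B C \<and> (b = x ! 0 \<or> b = x ! 1)},
      tail = tl,
      head = (\<lambda>a. [hd a])\<rparr>"

text \<open>An arc is a list determined by its tail \<open>tl\<close> and the singleton of its
  \<open>hd\<close>, so there are no parallel arcs. The out-degree is 2, not 1, because
  \<open>e1\<close> and \<open>e2\<close> are distinct.\<close>

lemma binary_coincidence_digraph:
  "binary_digraph (coincidence_digraph BB CC A B C)
     (coincidences BB CC A B C) ((\<lambda>e. [e]) ` Hom CC B C)"
proof -
  let ?D = "coincidence_digraph BB CC A B C"
  have "nomulti_digraph ?D"
  proof
    fix a assume "a \<in> arcs ?D"
    then show "tail ?D a \<in> verts ?D" "head ?D a \<in> verts ?D"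
      by (cases a; auto simp: coincidence_digraph_def coincidences_def)+
  next
    fix a b assume "a \<in> arcs ?D" "b \<in> arcs ?D" "arc_to_ends ?D a = arc_to_ends ?D b"
    then show "a = b"
      by (cases a; cases b) (auto simp: coincidence_digraph_def arc_to_ends_def)
  qed
  moreover have "out_degree ?D x = 2" if "x \<in> coincidences BB CC A B C" for x
  proof -
    obtain e1 e2 u v where x: "x = [e1, e2, u, v]" "e1 \<noteq> e2"
      using \<open>x \<in> _\<close> by (auto simp: coincidences_def)
    have "a \<in> out_arcs ?D x \<longleftrightarrow> a \<in> {e1 # x, e2 # x}" for a
      using \<open>x \<in> _\<close> by (cases a) (auto simp: out_arcs_def coincidence_digraph_def x(1))
    then have "out_arcs ?D x = {e1 # x, e2 # x}"
      by blast
    then show ?thesis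
      using x(2) by (simp add: out_degree_def)
  qed
  moreover have "tail ?D a \<in> coincidences BB CC A B C \<and> head ?D a \<in> (\<lambda>e. [e]) ` Hom CC B C"
    if "a \<in> arcs ?D" for a
    using that by (cases a) (auto simp: coincidence_digraph_def coincidences_def)
  ultimately show ?thesis
    by (auto simp: binary_digraph_def coincidence_digraph_def coincidences_def)
qed

lemma coherent_endomorphisms:
  fixes CC BB :: "('o, 'm) cat" and A B C :: 'o
  assumes cat: "category CC"
    and mono: "\<forall>f \<in> Arr CC. monic CC f"
    and sub: "subcategory BB CC"
    and B: "B \<in> Obj BB" and C: "C \<in> Obj CC"
    and A: "A \<in> Obj (Age BB B)"
    and cocone: "\<forall>(\<Delta> :: ('m list, 'm list) pre_digraph) Lo Up Fo Fa.
           AB_diagram (Age BB B) A B \<Delta> Lo Up Fo Fa \<longrightarrow>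
           (\<exists>e. commuting_cocone (Age CC C) \<Delta> Fo Fa C e) \<longrightarrow>
           (\<exists>D e. commuting_cocone (Age BB B) \<Delta> Fo Fa D e)"
  obtains f where "\<And>e. e \<in> Hom CC B C \<Longrightarrow> f e \<in> Hom BB B B"
    and "\<And>e1 e2 u v. \<lbrakk>e1 \<in> Hom CC B C; e2 \<in> Hom CC B C; u \<in> Hom BB A B; v \<in> Hom BB A B;
           Comp CC e1 u = Comp CC e2 v\<rbrakk> \<Longrightarrow> Comp BB (f e1) u = Comp BB (f e2) v"
proof -
  interpret C: category CC by fact
  interpret B: category BB using sub by (simp add: subcategory_def)
  let ?D = "coincidence_digraph BB CC A B C"
  let ?L = "coincidences BB CC A B C"
  let ?U = "(\<lambda>e. [e]) ` Hom CC B C"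
  define Fo :: "'m list \<Rightarrow> 'o" where "Fo x = (if x \<in> ?L then A else B)" for x
  \<comment> \<open>An arc reads \<open>[b, e1, e2, u, v]\<close>, so positions are shifted by one
    against its tail vertex. The arrow to \<open>[e1]\<close> carries \<open>u\<close>, the one to
    \<open>[e2]\<close> carries \<open>v\<close>.\<close>
  define Fa :: "'m list \<Rightarrow> 'm" where "Fa a = (if hd a = a ! 1 then a ! 3 else a ! 4)" for a
  \<comment> \<open>At a bottom vertex the cocone is the common composite of the coincidence; at a
    top vertex it is the index itself.\<close>
  define e :: "'m list \<Rightarrow> 'm" where
    "e x = (if x \<in> ?L then Comp CC (x ! 0) (x ! 2) else hd x)" for x
  have bin: "binary_digraph ?D ?L ?U"
    by (rule binary_coincidence_digraph)
  then have wf: "wf_digraph ?D"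
    by (simp add: binary_digraph_def nomulti_digraph_def)
  have verts: "verts ?D = ?L \<union> ?U" and not_low: "[x] \<notin> ?L" for x
    by (auto simp: coincidence_digraph_def coincidences_def)
  have arcE: thesis
    if a_arc: "a \<in> arcs ?D"
      and cases: "\<And>e1 e2 u v. \<lbrakk>[e1, e2, u, v] \<in> ?L; e1 \<in> Hom CC B C; e2 \<in> Hom CC B C; e1 \<noteq> e2;
        u \<in> Hom BB A B; v \<in> Hom BB A B; Comp CC e1 u = Comp CC e2 v;
        a = [e1, e1, e2, u, v] \<or> a = [e2, e1, e2, u, v]\<rbrakk> \<Longrightarrow> thesis" for a thesis
  proof -
    obtain b l where a: "a = b # l" "l \<in> ?L" "b = a ! 1 \<or> b = a ! 2"
      using a_arc by (cases a) (auto simp: coincidence_digraph_def)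
    from a(2) obtain e1 e2 u v where "l = [e1, e2, u, v]" "e1 \<in> Hom CC B C" "e2 \<in> Hom CC B C"
      "e1 \<noteq> e2" "u \<in> Hom BB A B" "v \<in> Hom BB A B" "Comp CC e1 u = Comp CC e2 v"
      by (auto simp: coincidences_def)
    with a show thesis
      by (intro cases[of e1 e2 u v]) auto
  qed
  have A_obj: "A \<in> Obj BB" "Hom BB A B \<noteq> {}"
    using A by (auto simp: Obj_Age)
  have BB_obj: "Hom BB B B \<noteq> {}"
    using B.Ident_in[OF B] by blast
  have comp: "Comp CC x u \<in> Hom CC A C" if "x \<in> Hom CC B C" "u \<in> Hom BB A B" for x u
    using that C.Comp_in Hom_subcategory[OF sub] by blast
  have "AB_diagram (Age BB B) A B ?D ?L ?U Fo Fa"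
    unfolding AB_diagram_def diagram_def
  proof (intro conjI ballI bin wf)
    fix x show "Fo x \<in> Obj (Age BB B)"
      using A B.self_in_Age[OF B] by (simp add: Fo_def)
  next
    fix a assume "a \<in> arcs ?D"
    then show "Fa a \<in> Hom (Age BB B) (Fo (tail ?D a)) (Fo (head ?D a))"
      by (rule arcE)
        (use A_obj B BB_obj in \<open>auto simp: Fa_def Fo_def Hom_Age coincidence_digraph_def not_low\<close>)
  qed (auto simp: Fo_def not_low)
  moreover have "commuting_cocone (Age CC C) ?D Fo Fa C e"
    unfolding commuting_cocone_def
  proof (intro conjI ballI)
    show C_age: "C \<in> Obj (Age CC C)"
      using C.self_in_Age[OF C] .
    fix x assume "x \<in> verts ?D"
    then have "e x \<in> Hom CC (Fo x) C"
      using comp by (auto simp: verts e_def Fo_def not_low) (auto simp: coincidences_def)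
    moreover have "Fo x \<in> Obj CC"
      using A_obj B sub by (auto simp: Fo_def subcategory_def)
    ultimately show "e x \<in> Hom (Age CC C) (Fo x) C"
      using C_age by (auto simp: Hom_Age Obj_Age)
  next
    fix a assume "a \<in> arcs ?D"
    then show "Comp (Age CC C) (e (head ?D a)) (Fa a) = e (tail ?D a)"
      by (rule arcE) (auto simp: Fa_def e_def coincidence_digraph_def not_low)
  qed
  ultimately obtain D g where g: "commuting_cocone (Age BB B) ?D Fo Fa D g"
    using cocone by blast
  then have "D \<in> Obj (Age BB B)"
    by (simp add: commuting_cocone_def)
  \<comment> \<open>The tip lies in the age of \<open>B\<close>, so it maps back to
    \<open>B\<close>.\<close>
  then obtain h where h: "h \<in> Hom BB D B"
    by (auto simp: Obj_Age)
  have g_top: "g [x] \<in> Hom BB B D" if "x \<in> Hom CC B C" for x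
  proof -
    have "g [x] \<in> Hom (Age BB B) (Fo [x]) D"
      using g that unfolding commuting_cocone_def verts by blast
    then show ?thesis
      by (simp add: Fo_def not_low Hom_Age split: if_splits)
  qed
  show thesis
  proof (rule that[of "\<lambda>x. Comp BB h (g [x])"])
    fix x assume "x \<in> Hom CC B C"
    then show "Comp BB h (g [x]) \<in> Hom BB B B"
      using g_top h B.Comp_in by blast
  next
    fix e1 e2 u v
    assume e: "e1 \<in> Hom CC B C" "e2 \<in> Hom CC B C"
      and uv: "u \<in> Hom BB A B" "v \<in> Hom BB A B" and eq: "Comp CC e1 u = Comp CC e2 v"
    have "Comp BB (g [e1]) u = Comp BB (g [e2]) v"
    proof (cases "e1 = e2")
      \<comment> \<open>The digraph has no vertex for this case, since both arrows would end in the
        same top vertex.\<close>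
      case True
      have "monic CC e1" "Dom CC e1 = B"
        using mono e(1) by (auto simp: Hom_def)
      moreover have "u \<in> Hom CC A B" "v \<in> Hom CC A B" "A \<in> Obj CC"
        using uv Hom_subcategory[OF sub] A_obj sub by (auto simp: subcategory_def)
      ultimately have "u = v"
        using eq True by (simp add: monic_def)
      then show ?thesis
        using True by simp
    next
      case False
      let ?x = "[e1, e2, u, v]"
      have "?x \<in> ?L"
        using e uv eq False by (auto simp: coincidences_def)
      then have arcs: "e1 # ?x \<in> arcs ?D" "e2 # ?x \<in> arcs ?D"
        by (auto simp: coincidence_digraph_def)
      have "Comp BB (g (head ?D a)) (Fa a) = g (tail ?D a)" if "a \<in> arcs ?D" for a
        using g that by (simp add: commuting_cocone_def)
      from this[OF arcs(1)] this[OF arcs(2)] show ?thesis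
        using False by (simp add: coincidence_digraph_def Fa_def)
    qed
    then show "Comp BB (Comp BB h (g [e1])) u = Comp BB (Comp BB h (g [e2])) v"
      using B.Comp_assoc[OF uv(1) g_top[OF e(1)] h] B.Comp_assoc[OF uv(2) g_top[OF e(2)] h]
      by simp
  qed
qed

text \<open>Both \<open>k\<close> and \<open>t\<close> carry over: the new colouring uses the same
  \<open>k\<close> colours, and the colours seen through the endomorphism are among those seen
  through \<open>w\<close>.\<close>

lemma ramsey_arrow_transfer:
  assumes cat: "category CC" and sub: "subcategory BB CC"
    and ne: "Hom CC B C \<noteq> {}" and k: "k \<ge> 1"
    and f: "\<And>e. e \<in> Hom CC B C \<Longrightarrow> f e \<in> Hom BB B B"
    and coh: "\<And>e1 e2 u v. \<lbrakk>e1 \<in> Hom CC B C; e2 \<in> Hom CC B C; u \<in> Hom BB A B; v \<in> Hom BB A B;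
           Comp CC e1 u = Comp CC e2 v\<rbrakk> \<Longrightarrow> Comp BB (f e1) u = Comp BB (f e2) v"
    and arrow: "ramsey_arrow CC C C A k t"
  shows "ramsey_arrow BB B B A k t"
  unfolding ramsey_arrow_def
proof
  interpret C: category CC by fact
  interpret B: category BB using sub by (simp add: subcategory_def)
  fix \<chi> assume \<chi>: "\<chi> \<in> Hom BB A B \<rightarrow> {..<k}"
  let ?P = "\<lambda>x (e, u). e \<in> Hom CC B C \<and> u \<in> Hom BB A B \<and> x = Comp CC e u"
  \<comment> \<open>A factorisation of \<open>x\<close> is picked by choice; \<open>coh\<close>
    makes the colour independent of the pick. The default 0 is a legal colour because
    \<open>k\<close> is positive.\<close>
  define \<chi>' where "\<chi>' x = (if \<exists>p. ?P x p
    then (case SOME p. ?P x p of (e, u) \<Rightarrow> \<chi> (Comp BB (f e) u)) else 0)" for x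
  have \<chi>'_eq: "\<chi>' (Comp CC e u) = \<chi> (Comp BB (f e) u)"
    if eu: "e \<in> Hom CC B C" "u \<in> Hom BB A B" for e u
  proof -
    let ?x = "Comp CC e u"
    obtain e' u' where p: "(SOME p. ?P ?x p) = (e', u')"
      by (rule prod.exhaust)
    have ex: "\<exists>p. ?P ?x p"
      using eu by auto
    then have "?P ?x (e', u')"
      unfolding p[symmetric] by (rule someI_ex)
    then have "Comp BB (f e) u = Comp BB (f e') u'"
      using eu by (intro coh) auto
    then show ?thesis
      unfolding \<chi>'_def if_P[OF ex] p by simp
  qed
  have bound: "\<chi>' x < k" for x
  proof (cases "\<exists>p. ?P x p")
    case True
    then obtain e u where eu: "e \<in> Hom CC B C" "u \<in> Hom BB A B" "x = Comp CC e u"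
      by auto
    then have "Comp BB (f e) u \<in> Hom BB A B"
      using f B.Comp_in by blast
    then show ?thesis
      using \<chi>'_eq[OF eu(1,2)] \<chi> eu(3) by auto
  next
    case False
    then show ?thesis
      using k by (simp only: \<chi>'_def if_False)
  qed
  then have "\<chi>' \<in> Hom CC A C \<rightarrow> {..<k}"
    by simp
  then obtain w where w: "w \<in> Hom CC C C" "card (\<chi>' ` Comp CC w ` Hom CC A C) \<le> t"
    using arrow unfolding ramsey_arrow_def by blast
  obtain e0 where e0: "e0 \<in> Hom CC B C"
    using ne by blast
  let ?e = "Comp CC w e0"
  have e: "?e \<in> Hom CC B C"
    using C.Comp_in[OF e0 w(1)] .
  have "\<chi> ` Comp BB (f ?e) ` Hom BB A B \<subseteq> \<chi>' ` Comp CC w ` Hom CC A C"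
  proof (clarsimp simp: image_image)
    fix u assume u: "u \<in> Hom BB A B"
    then have uC: "u \<in> Hom CC A B"
      using Hom_subcategory[OF sub] by blast
    have "\<chi> (Comp BB (f ?e) u) = \<chi>' (Comp CC w (Comp CC e0 u))"
      using \<chi>'_eq[OF e u] C.Comp_assoc[OF uC e0 w(1)] by simp
    then show "\<chi> (Comp BB (f ?e) u) \<in> (\<lambda>x. \<chi>' (Comp CC w x)) ` Hom CC A C"
      using C.Comp_in[OF uC e0] by blast
  qed
  \<comment> \<open>Needed for \<open>card_mono\<close>, as \<open>card\<close> of an infinite set
    is 0.\<close>
  moreover have "finite (\<chi>' ` Comp CC w ` Hom CC A C)"
    using bound by (auto intro: finite_subset[of _ "{..<k}"])
  ultimately have "card (\<chi> ` Comp BB (f ?e) ` Hom BB A B) \<le> t"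
    using w(2) by (meson card_mono order_trans)
  then show "\<exists>w \<in> Hom BB B B. card (\<chi> ` Comp BB w ` Hom BB A B) \<le> t"
    using f[OF e] by blast
qed

text \<open>The least bound on the right, good for all \<open>k\<close> at once, is also a bound on
  the left; if there is none, the right side is infinite.\<close>

lemma T_mono:
  assumes "\<And>k t. \<lbrakk>k \<ge> 2; ramsey_arrow C Z Z A k t\<rbrakk> \<Longrightarrow> ramsey_arrow C' Z' Z' A' k t"
  shows "T C' A' Z' \<le> T C A Z"
proof (cases "\<exists>t \<ge> 1. \<forall>k \<ge> 2. ramsey_arrow C Z Z A k t")
  case True
  let ?t = "LEAST t. t \<ge> 1 \<and> (\<forall>k \<ge> 2. ramsey_arrow C Z Z A k t)"
  have "?t \<ge> 1 \<and> (\<forall>k \<ge> 2. ramsey_arrow C Z Z A k ?t)"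
    by (rule LeastI_ex) (use True in blast)
  then have t: "?t \<ge> 1 \<and> (\<forall>k \<ge> 2. ramsey_arrow C' Z' Z' A' k ?t)"
    using assms by blast
  then have "(LEAST t. t \<ge> 1 \<and> (\<forall>k \<ge> 2. ramsey_arrow C' Z' Z' A' k t)) \<le> ?t"
    by (rule Least_le)
  moreover have "\<exists>t \<ge> 1. \<forall>k \<ge> 2. ramsey_arrow C' Z' Z' A' k t"
    using t by blast
  ultimately show ?thesis
    using True by (simp only: T_def if_True enat_ord_simps)
next
  case False
  then show ?thesis
    by (simp only: T_def if_False enat_ord_simps)
qed

theorem theorem3p9:
  fixes CC BB :: "('o, 'm) cat" and A B C :: 'o
  assumes "category CC"
    and "\<forall>f \<in> Arr CC. monic CC f"
    and "subcategory BB CC"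
    and "B \<in> Obj BB" and "C \<in> Obj CC"
    and "Hom CC B C \<noteq> {}"
    and "A \<in> Obj (Age BB B)"
    and "\<forall>(\<Delta> :: ('m list, 'm list) pre_digraph) Lo Up Fo Fa.
           AB_diagram (Age BB B) A B \<Delta> Lo Up Fo Fa \<longrightarrow>
           (\<exists>e. commuting_cocone (Age CC C) \<Delta> Fo Fa C e) \<longrightarrow>
           (\<exists>D e. commuting_cocone (Age BB B) \<Delta> Fo Fa D e)"
  shows "T BB A B \<le> T CC A C"
proof -
  obtain f where f: "\<And>e. e \<in> Hom CC B C \<Longrightarrow> f e \<in> Hom BB B B"
    and coh: "\<And>e1 e2 u v. \<lbrakk>e1 \<in> Hom CC B C; e2 \<in> Hom CC B C; u \<in> Hom BB A B; v \<in> Hom BB A B;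
           Comp CC e1 u = Comp CC e2 v\<rbrakk> \<Longrightarrow> Comp BB (f e1) u = Comp BB (f e2) v"
    using coherent_endomorphisms[OF assms(1-5,7,8)] by metis
  show ?thesis
  proof (rule T_mono)
    fix k t :: nat assume "k \<ge> 2" and "ramsey_arrow CC C C A k t"
    then show "ramsey_arrow BB B B A k t"
      using ramsey_arrow_transfer[OF assms(1,3,6) _ f coh] by simp
  qed
qed

end
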